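(* Let $h\in L^1(\mathbb{R})$ and $a,b,c,t_0\in\mathbb{R}$, and let $\tilde u,\tilde v:\mathbb{R}\to\mathbb{R}$ be the unique solutions on $\mathbb{R}$ of $$\tilde u'(t)+a\,\tilde u(-t)+b\,\tilde u(t)=0,\ \tilde u(0)=1,\qquad \tilde v'(t)-a\,\tilde v(-t)+b\,\tilde v(t)=0,\ \tilde v(0)=1 .$$ Suppose that $\tilde u(t_0)\neq0$. Then the unique solution of the problem $$x'(t)+a\,x(-t)+b\,x(t)=h(t),\quad t\in\mathbb{R},\qquad x(t_0)=c,$$ is given by $$u(t)=\int_{-\infty}^{\infty}G(t,s)h(s)\,ds+\frac{c-u_0(t_0)}{\tilde u(t_0)}\,\tilde u(t),\qquad t\in\mathbb{R},$$ where, for $t,s\in\mathbb{R}$, $$G(t,s):=\tfrac12\Big([\tilde u(-s)\tilde v(t)+\tilde v(-s)\tilde u(t)]\,\chi_0^t(s)+[\tilde u(-s)\tilde v(t)-\tilde v(-s)\tilde u(t)]\,\chi_{-t}^0(s)\Big),$$ and $u_0$ and $\chi_{t_1}^{t_2}$ are as defined in the context.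
   Context: A solution is a locally absolutely continuous function $x:\mathbb{R}\to\mathbb{R}$ satisfying the equation almost everywhere and the initial condition. For a function $f$ on $\mathbb{R}$, $f_e(t)=\frac{f(t)+f(-t)}2$ and $f_o(t)=\frac{f(t)-f(-t)}2$ are its even and odd parts. The function $u_0$ is $$u_0(t):=\tilde u(t)\int_0^t\big(h_o\tilde v_e-h_e\tilde v_o\big)(s)\,ds+\tilde v(t)\int_0^t\big(h_e\tilde u_e-h_o\tilde u_o\big)(s)\,ds .$$ For $t_1,t_2\in\mathbb{R}$ the oriented characteristic function is $\chi_{t_1}^{t_2}(t)=1$ if $t_1\le t\le t_2$, $\chi_{t_1}^{t_2}(t)=-1$ if $t_2\le t<t_1$, and $\chi_{t_1}^{t_2}(t)=0$ otherwise (so $\int_{t_1}^{t_2}f=\int_{\mathbb{R}}\chi_{t_1}^{t_2}f$). *)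

theory Defs
  imports "HOL-Analysis.Analysis"
begin

definition abs_continuous_on :: "real \<Rightarrow> real \<Rightarrow> (real \<Rightarrow> real) \<Rightarrow> bool" where
  "abs_continuous_on p q f \<longleftrightarrow>
    (\<forall>\<epsilon>>0. \<exists>\<delta>>0. \<forall>D :: (real \<times> real) set.
       finite D \<longrightarrow>
       (\<forall>(l, r) \<in> D. p \<le> l \<and> l \<le> r \<and> r \<le> q) \<longrightarrow>
       disjoint_family_on (\<lambda>(l, r). {l<..<r}) D \<longrightarrow>
       (\<Sum>(l, r) \<in> D. r - l) < \<delta> \<longrightarrow>
       (\<Sum>(l, r) \<in> D. \<bar>f r - f l\<bar>) < \<epsilon>)"

definition locally_abs_continuous :: "(real \<Rightarrow> real) \<Rightarrow> bool" where
  "locally_abs_continuous f \<longleftrightarrow> (\<forall>p q. abs_continuous_on p q f)"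

definition is_solution ::
  "real \<Rightarrow> real \<Rightarrow> (real \<Rightarrow> real) \<Rightarrow> real \<Rightarrow> real \<Rightarrow> (real \<Rightarrow> real) \<Rightarrow> bool" where
  "is_solution a b h t0 c x \<longleftrightarrow>
     locally_abs_continuous x \<and>
     (AE t in lebesgue. x differentiable (at t) \<and> deriv x t + a * x (- t) + b * x t = h t) \<and>
     x t0 = c"

definition even_part :: "(real \<Rightarrow> real) \<Rightarrow> real \<Rightarrow> real" where
  "even_part f t = (f t + f (- t)) / 2"

definition odd_part :: "(real \<Rightarrow> real) \<Rightarrow> real \<Rightarrow> real" where
  "odd_part f t = (f t - f (- t)) / 2"

text \<open>The interval integrals are oriented, and are taken over the completed measure because
  an integrable \<open>h\<close> need only be Lebesgue measurable, not Borel measurable.\<close>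

definition u0 ::
  "(real \<Rightarrow> real) \<Rightarrow> (real \<Rightarrow> real) \<Rightarrow> (real \<Rightarrow> real) \<Rightarrow> real \<Rightarrow> real" where
  "u0 h u v t =
     u t * (LINT s=0..t|lebesgue. (odd_part h s * even_part v s - even_part h s * odd_part v s)) +
     v t * (LINT s=0..t|lebesgue. (even_part h s * even_part u s - odd_part h s * odd_part u s))"

definition oriented_char :: "real \<Rightarrow> real \<Rightarrow> real \<Rightarrow> real" where
  "oriented_char t1 t2 t =
     (if t1 \<le> t \<and> t \<le> t2 then 1 else if t2 \<le> t \<and> t < t1 then - 1 else 0)"

definition G :: "(real \<Rightarrow> real) \<Rightarrow> (real \<Rightarrow> real) \<Rightarrow> real \<Rightarrow> real \<Rightarrow> real" where
  "G u v t s =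
     1 / 2 * ((u (- s) * v t + v (- s) * u t) * oriented_char 0 t s +
              (u (- s) * v t - v (- s) * u t) * oriented_char (- t) 0 s)"

end

(* Write f*(t) = f(-t) for the reflection. For a solution x of the full equation, the reflected
   Wronskians v* x + v x* and u* x - u x* have derivatives v* h - v h* and u* h + u h* almost
   everywhere: all terms without h cancel. With h = 0 and x = u the first one is constant, equal
   to 2, and then Cramer's rule recovers x from the two Wronskians; this is variation of constants
   and gives x = u0 + x(0) u. Splitting the integrand of u0 into its h(s) and h(-s) halves and
   reflecting the latter turns u0 into the integral against the Green function G.

   Two facts about Lebesgue integration carry the argument. An absolutely continuous function
   with zero derivative almost everywhere is constant (Cousin's lemma, with a gauge that forces
   the intervals tagged in the exceptional null set into a small open set), and an indefinite
   integral is differentiable almost everywhere (Henstock's lemma and the Vitali covering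
   theorem). *)

theory Submission
  imports Defs
begin

subsection \<open>Absolute continuity\<close>

text \<open>Links measure to absolute continuity: intervals inside a set of small measure have the
  small total length that the definition asks for.\<close>

lemma sum_length_le_measure:
  fixes D :: "(real \<times> real) set"
  assumes "finite D" and le: "\<And>l r. (l, r) \<in> D \<Longrightarrow> l \<le> r"
    and disj: "disjoint_family_on (\<lambda>(l, r). {l<..<r}) D"
    and sub: "\<And>l r. (l, r) \<in> D \<Longrightarrow> {l<..<r} \<subseteq> U" and U: "U \<in> sets lebesgue"
  shows "ennreal (\<Sum>(l, r)\<in>D. r - l) \<le> emeasure lebesgue U"
proof -
  have "ennreal (\<Sum>(l, r)\<in>D. r - l) = (\<Sum>i\<in>D. emeasure lebesgue ((\<lambda>(l, r). {l<..<r}) i))"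
    using le by (subst sum_ennreal[symmetric]) (auto intro!: sum.cong)
  also have "\<dots> = emeasure lebesgue (\<Union>i\<in>D. (\<lambda>(l, r). {l<..<r}) i)"
    by (intro sum_emeasure assms) auto
  also have "\<dots> \<le> emeasure lebesgue U"
    using sub U by (intro emeasure_mono) auto
  finally show ?thesis .
qed

text \<open>Cousin's lemma divides \<open>{p..q}\<close> subject to a gauge adapted to the null set
  \<open>N\<close> of bad points. Intervals tagged in \<open>N\<close> have total length below
  \<open>\<delta>\<close>, so absolute continuity controls their increments; elsewhere the zero
  derivative bounds each increment by \<open>\<epsilon>\<close> times the length.\<close>

lemma abs_continuous_on_zero_derivative_imp_eq:
  assumes ac: "abs_continuous_on p q f" and "p \<le> q"
    and der: "AE t in lebesgue. (f has_real_derivative 0) (at t)"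
  shows "f p = f q"
proof -
  \<comment> \<open>The \<open>1\<close> accounts for the intervals tagged in the null set,
    \<open>q - p\<close> for all others.\<close>
  have "\<bar>f q - f p\<bar> \<le> \<epsilon> * (1 + (q - p))" if "\<epsilon> > 0" for \<epsilon>
  proof -
    define N where "N = {t. \<not> (f has_real_derivative 0) (at t)}"
    have N: "N \<in> null_sets lebesgue"
      using der unfolding N_def by (simp add: AE_iff_null_sets completion.AE_iff_null_sets)
    obtain \<delta> where "\<delta> > 0"
      and \<delta>: "\<And>D. finite D \<Longrightarrow> (\<forall>(l, r) \<in> D. p \<le> l \<and> l \<le> r \<and> r \<le> q) \<Longrightarrow>
        disjoint_family_on (\<lambda>(l, r). {l<..<r}) D \<Longrightarrow> (\<Sum>(l, r) \<in> D. r - l) < \<delta> \<Longrightarrow>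
        (\<Sum>(l, r) \<in> D. \<bar>f r - f l\<bar>) < \<epsilon>"
      using ac \<open>\<epsilon> > 0\<close> unfolding abs_continuous_on_def by meson
    \<comment> \<open>Outer regularity; as \<open>N\<close> is null, the bound on
      \<open>U - N\<close> passes to \<open>U\<close>.\<close>
    obtain U where U: "open U" "N \<subseteq> U" "emeasure lebesgue (U - N) < ennreal \<delta>"
      using sets_lebesgue_outer_open[of N \<delta>] N \<open>\<delta> > 0\<close> by (metis null_setsD2)
    have Us: "U \<in> sets lebesgue"
      using U(1) by simp
    have mU: "emeasure lebesgue U < ennreal \<delta>"
      using U(3) emeasure_Diff_null_set[OF N Us] by simp
    have "\<exists>d>0. \<forall>y. \<bar>y - t\<bar> < d \<longrightarrow> \<bar>f y - f t\<bar> \<le> \<epsilon> * \<bar>y - t\<bar>" if "t \<notin> N" for t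
    proof -
      have "(f has_derivative (\<lambda>_. 0)) (at t)"
        using that unfolding N_def by (simp add: has_field_derivative_def lambda_zero)
      then show ?thesis
        using \<open>\<epsilon> > 0\<close> unfolding has_derivative_at_alt by auto
    qed
    then obtain d where d: "\<And>t. t \<notin> N \<Longrightarrow> d t > 0"
      "\<And>t y. t \<notin> N \<Longrightarrow> \<bar>y - t\<bar> < d t \<Longrightarrow> \<bar>f y - f t\<bar> \<le> \<epsilon> * \<bar>y - t\<bar>"
      by metis
    \<comment> \<open>At tags in \<open>N\<close> the gauge confines intervals to \<open>U\<close>;
      at other tags, to a ball on which \<open>f\<close> departs from its value at the tag by at
      most \<open>\<epsilon>\<close> times the distance.\<close>
    define \<gamma> where "\<gamma> t = (if t \<in> N then U else ball t (d t))" for t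
    have "gauge \<gamma>"
      using U d unfolding gauge_def \<gamma>_def by auto
    then obtain P where P: "P tagged_division_of {p..q}" "\<gamma> fine P"
      using fine_division_exists_real by blast
    note PD = tagged_division_ofD[OF P(1)]
    have fin: "finite P" using PD by blast
    have Kx: "\<exists>l r. K = {l..r} \<and> l \<le> x \<and> x \<le> r \<and> p \<le> l \<and> r \<le> q \<and> {l..r} \<subseteq> \<gamma> x"
      if xK: "(x, K) \<in> P" for x K
    proof -
      obtain l r where lr: "K = {l..r}" using PD(4)[OF xK] by auto
      then have "l \<le> x" "x \<le> r" using PD(2)[OF xK] by auto
      moreover from this lr have "p \<le> l" "r \<le> q" using PD(3)[OF xK] by (auto simp: subset_iff)
      moreover have "K \<subseteq> \<gamma> x" using P(2) xK unfolding fine_def by auto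
      ultimately show ?thesis using lr by blast
    qed
    define PN where "PN = {z \<in> P. fst z \<in> N}"
    define D where "D = (\<lambda>(x, K). (Inf K, Sup K)) ` PN"
    \<comment> \<open>Distinct members of \<open>P\<close> with equal endpoints would be degenerate and contribute nothing,
      so passing from \<open>PN\<close> to the set \<open>D\<close> of endpoint pairs loses nothing.\<close>
    have degenerate: "Inf K = Sup K"
      if KL: "(x, K) \<in> P" "(y, L) \<in> P" "(x, K) \<noteq> (y, L)" "Inf K = Inf L" "Sup K = Sup L" for x y K L
    proof -
      obtain l r where "K = {l..r}" "l \<le> r" using Kx[OF KL(1)] by fastforce
      moreover obtain l' r' where "L = {l'..r'}" "l' \<le> r'" using Kx[OF KL(2)] by fastforce
      ultimately show ?thesis
        using PD(5)[OF KL(1-3)] KL(4,5) by (simp add: interior_atLeastAtMost_real)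
    qed
    have sumD: "(\<Sum>(l, r)\<in>D. g l r) = (\<Sum>(x, K)\<in>PN. g (Inf K) (Sup K))"
      if "\<And>z. g z z = 0" for g :: "real \<Rightarrow> real \<Rightarrow> real"
      unfolding D_def
    proof (subst sum.reindex_nontrivial)
      fix y z assume "y \<in> PN" "z \<in> PN" "y \<noteq> z"
        "(case y of (x, K) \<Rightarrow> (Inf K, Sup K)) = (case z of (x, K) \<Rightarrow> (Inf K, Sup K))"
      then show "(case case y of (x, K) \<Rightarrow> (Inf K, Sup K) of (l, r) \<Rightarrow> g l r) = 0"
        using degenerate[of "fst y" "snd y" "fst z" "snd z"] that
        by (auto simp: PN_def split: prod.splits)
    qed (use fin in \<open>auto simp: PN_def intro!: sum.cong\<close>)
    have finD: "finite D" unfolding D_def PN_def using fin by auto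
    have Dp: "p \<le> l \<and> l \<le> r \<and> r \<le> q \<and> {l..r} \<subseteq> U" if lr: "(l, r) \<in> D" for l r
    proof -
      obtain x L where xL: "(x, L) \<in> P" "x \<in> N" "l = Inf L" "r = Sup L"
        using lr unfolding D_def PN_def by auto
      then show ?thesis
        using Kx[OF xL(1)] by (auto simp: \<gamma>_def)
    qed
    have disj: "disjoint_family_on (\<lambda>(l, r). {l<..<r}) D"
      unfolding disjoint_family_on_def
    proof (intro ballI impI)
      fix m n assume mn: "m \<in> D" "n \<in> D" "m \<noteq> n"
      obtain x L where xL: "(x, L) \<in> P" "m = (Inf L, Sup L)" using mn unfolding D_def PN_def by auto
      obtain y M where yM: "(y, M) \<in> P" "n = (Inf M, Sup M)" using mn unfolding D_def PN_def by auto
      obtain l r where "L = {l..r}" "l \<le> r" using Kx[OF xL(1)] by fastforce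
      moreover obtain l' r' where "M = {l'..r'}" "l' \<le> r'" using Kx[OF yM(1)] by fastforce
      moreover have "interior L \<inter> interior M = {}"
        using PD(5)[OF xL(1) yM(1)] mn xL yM by auto
      ultimately show "(case m of (l, r) \<Rightarrow> {l<..<r}) \<inter> (case n of (l, r) \<Rightarrow> {l<..<r}) = {}"
        using xL yM by (simp add: interior_atLeastAtMost_real)
    qed
    have "ennreal (\<Sum>(l, r)\<in>D. r - l) \<le> emeasure lebesgue U"
      using Dp by (intro sum_length_le_measure finD disj Us) force+
    then have "ennreal (\<Sum>(l, r)\<in>D. r - l) < ennreal \<delta>"
      using mU by (rule le_less_trans)
    then have "(\<Sum>(l, r)\<in>D. r - l) < \<delta>"
      by (metis ennreal_leI linorder_not_le)
    then have "(\<Sum>(l, r)\<in>D. \<bar>f r - f l\<bar>) < \<epsilon>"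
      using Dp by (intro \<delta> finD disj) auto
    then have bad: "(\<Sum>(x, K)\<in>PN. \<bar>f (Sup K) - f (Inf K)\<bar>) < \<epsilon>"
      using sumD[of "\<lambda>l r. \<bar>f r - f l\<bar>"] by simp
    \<comment> \<open>The tag lies between the endpoints, so the estimate at the tag applies to both
      of them and the two bounds add up to \<open>\<epsilon>\<close> times the length.\<close>
    have "(\<Sum>(x, K)\<in>P - PN. \<bar>f (Sup K) - f (Inf K)\<bar>) \<le> (\<Sum>(x, K)\<in>P - PN. \<epsilon> * measure lborel K)"
    proof (rule sum_mono, clarify)
      fix x K assume xK: "(x, K) \<in> P" "(x, K) \<notin> PN"
      then have x: "x \<notin> N" by (auto simp: PN_def)
      obtain l r where lr: "K = {l..r}" "l \<le> x" "x \<le> r" "{l..r} \<subseteq> \<gamma> x"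
        using Kx[OF xK(1)] by blast
      then have "l \<in> \<gamma> x" "r \<in> \<gamma> x" by auto
      then have "\<bar>f l - f x\<bar> \<le> \<epsilon> * \<bar>l - x\<bar>" "\<bar>f r - f x\<bar> \<le> \<epsilon> * \<bar>r - x\<bar>"
        using x d(2) by (auto simp: \<gamma>_def dist_real_def)
      moreover have "\<epsilon> * \<bar>l - x\<bar> + \<epsilon> * \<bar>r - x\<bar> = \<epsilon> * (r - l)"
        using lr by (simp add: algebra_simps)
      ultimately show "\<bar>f (Sup K) - f (Inf K)\<bar> \<le> \<epsilon> * measure lborel K"
        using lr by simp
    qed
    also have "\<dots> \<le> (\<Sum>(x, K)\<in>P. \<epsilon> * measure lborel K)"
      using fin \<open>\<epsilon> > 0\<close> by (intro sum_mono2) auto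
    also have "\<dots> = \<epsilon> * (q - p)"
      using additive_content_tagged_division[of P p q] P(1) \<open>p \<le> q\<close>
      by (simp add: sum_distrib_left[symmetric] split_def)
    finally have good: "(\<Sum>(x, K)\<in>P - PN. \<bar>f (Sup K) - f (Inf K)\<bar>) \<le> \<epsilon> * (q - p)" .
    have "\<bar>f q - f p\<bar> = \<bar>\<Sum>(x, K)\<in>P. f (Sup K) - f (Inf K)\<bar>"
      using additive_tagged_division_1[OF \<open>p \<le> q\<close> P(1), of f] by simp
    also have "\<dots> \<le> (\<Sum>(x, K)\<in>P. \<bar>f (Sup K) - f (Inf K)\<bar>)"
      by (rule order_trans[OF sum_abs]) (simp add: split_def)
    also have "\<dots> = (\<Sum>(x, K)\<in>P - PN. \<bar>f (Sup K) - f (Inf K)\<bar>) + (\<Sum>(x, K)\<in>PN. \<bar>f (Sup K) - f (Inf K)\<bar>)"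
      by (rule sum.subset_diff) (use fin in \<open>auto simp: PN_def\<close>)
    also have "\<dots> \<le> \<epsilon> * (1 + (q - p))"
      using bad good by (simp add: algebra_simps)
    finally show ?thesis .
  qed
  note bound = this
  have "\<bar>f q - f p\<bar> \<le> 0 + e" if "e > 0" for e
  proof -
    have pos: "1 + (q - p) > 0" using \<open>p \<le> q\<close> by simp
    have "\<bar>f q - f p\<bar> \<le> e / (1 + (q - p)) * (1 + (q - p))"
      using that pos by (intro bound) simp
    then show ?thesis using pos by simp
  qed
  then have "\<bar>f q - f p\<bar> \<le> 0"
    by (rule field_le_epsilon)
  then show ?thesis by simp
qed

section \<open>Almost everywhere differentiability of indefinite integrals\<close>

text \<open>If the derivative fails at a point, difference quotients over arbitrarily short
  intervals miss \<open>g t\<close> by more than some fixed \<open>1 / real (Suc n)\<close>, so the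
  countably many sets \<open>E n\<close> exhaust the bad points. Each is cut to bounded pieces
  because Henstock's lemma works on a compact interval.\<close>

lemma negligible_not_has_derivative_integrand:
  fixes F g :: "real \<Rightarrow> real"
  assumes int: "\<And>p q. g integrable_on {p..q}"
    and F: "\<And>x y. x \<le> y \<Longrightarrow> F y - F x = integral {x..y} g"
  shows "negligible {t. \<not> (F has_real_derivative g t) (at t)}"
proof -
  define E where "E n = {t. \<forall>d>0. \<exists>y. y \<noteq> t \<and> \<bar>y - t\<bar> < d \<and>
      \<bar>F y - F t - g t * (y - t)\<bar> > \<bar>y - t\<bar> / real (Suc n)}" for n
  have neg: "negligible (E n \<inter> {-real m<..<real m})" (is "negligible ?S") for n m
    unfolding negligible_outer_le
  proof (intro allI impI)
    fix e :: real assume "e > 0"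
    \<comment> \<open>Each interval of \<open>K\<close> is shorter than \<open>real (Suc n)\<close>
      times its Henstock error; the division compensates for that factor.\<close>
    define e' where "e' = e / real (Suc n)"
    have "e' > 0" using \<open>e > 0\<close> by (simp add: e'_def)
    obtain \<gamma> where "gauge \<gamma>" and \<gamma>: "\<And>p. p tagged_partial_division_of (cbox (-real m) (real m)) \<Longrightarrow> \<gamma> fine p \<Longrightarrow>
        (\<Sum>(x, k)\<in>p. norm (measure lborel k *\<^sub>R g x - integral k g)) < e'"
      using Henstock_lemma[of g "-real m" "real m" e'] int \<open>e' > 0\<close> by auto
    \<comment> \<open>The intervals witnessing \<open>t \<in> E n\<close> form a Vitali cover; being tagged at the endpoint \<open>t\<close>
      and fine, disjoint ones have small total length by Henstock's lemma.\<close>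
    define I where "I = (\<lambda>(t, y). {min t y..max t y :: real})"
    define K where "K = {(t, y). t \<in> ?S \<and> y \<noteq> t \<and> I (t, y) \<subseteq> \<gamma> t \<and> I (t, y) \<subseteq> {-real m..real m} \<and>
      \<bar>F y - F t - g t * (y - t)\<bar> > \<bar>y - t\<bar> / real (Suc n)}"
    \<comment> \<open>Midpoint and half-length present \<open>I (t, y)\<close> as a closed ball, the
      shape the Vitali theorem works with.\<close>
    define a where "a = (\<lambda>(t, y). (t + y) / 2 :: real)"
    define \<rho> where "\<rho> = (\<lambda>(t, y). \<bar>y - t\<bar> / 2 :: real)"
    have cb: "cball (a i) (\<rho> i) = I i" for i
      by (cases i) (auto simp: a_def \<rho>_def I_def cball_eq_atLeastAtMost min_def max_def field_simps)
    obtain C where C: "countable C" "C \<subseteq> K"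
     "pairwise (\<lambda>i j. disjnt (cball (a i) (\<rho> i)) (cball (a j) (\<rho> j))) C"
     "negligible (?S - (\<Union>i \<in> C. cball (a i) (\<rho> i)))"
    proof (rule Vitali_covering_theorem_cballs[of K \<rho> ?S a])
      show "0 < \<rho> i" if "i \<in> K" for i
        using that by (auto simp: K_def \<rho>_def)
      fix t d :: real assume t: "t \<in> ?S" and "d > 0"
      have "open (\<gamma> t \<inter> {-real m<..<real m})" "t \<in> \<gamma> t \<inter> {-real m<..<real m}"
        using \<open>gauge \<gamma>\<close> t unfolding gauge_def by auto
      then obtain k where "k > 0" and k: "cball t k \<subseteq> \<gamma> t \<inter> {-real m<..<real m}"
        using open_contains_cball by metis
      obtain y where y: "y \<noteq> t" "\<bar>y - t\<bar> < min d k" 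
        "\<bar>F y - F t - g t * (y - t)\<bar> > \<bar>y - t\<bar> / real (Suc n)"
      proof -
        have "min d k > 0" using \<open>d > 0\<close> \<open>k > 0\<close> by simp
        moreover have "t \<in> E n" using t by blast
        ultimately show ?thesis using that unfolding E_def by blast
      qed
      have "I (t, y) \<subseteq> cball t k"
        using y(2) by (auto simp: I_def cball_eq_atLeastAtMost)
      then have "I (t, y) \<subseteq> \<gamma> t" "I (t, y) \<subseteq> {-real m..real m}"
        using k by fastforce+
      then have "(t, y) \<in> K"
        using t y unfolding K_def by auto
      moreover have "t \<in> cball (a (t, y)) (\<rho> (t, y))"
        unfolding cb by (auto simp: I_def)
      moreover have "\<rho> (t, y) < d"
        using y \<open>d > 0\<close> by (auto simp: \<rho>_def)
      ultimately show "\<exists>i. i \<in> K \<and> t \<in> cball (a i) (\<rho> i) \<and> \<rho> i < d"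
        by blast
    qed
    have fm: "I i \<in> lmeasurable" for i
      by (cases i) (auto simp: I_def)
    \<comment> \<open>A bound uniform over finite subfamilies carries over to the countable union
      over \<open>C\<close>.\<close>
    have bound: "measure lebesgue (\<Union>i\<in>J. I i) \<le> e" if J: "J \<subseteq> C" "finite J" for J
    proof -
      have JK: "J \<subseteq> K" using J C by auto
      define P where "P = (\<lambda>i. (fst i, I i)) ` J"
      \<comment> \<open>Tag and interval determine the other endpoint, so sums over \<open>P\<close>
        and over \<open>J\<close> agree.\<close>
      have inj: "inj_on (\<lambda>i. (fst i, I i)) J"
      proof (rule inj_onI)
        fix i j :: "real \<times> real" assume "(fst i, I i) = (fst j, I j)"
        then show "i = j"
          by (cases i; cases j) (auto simp: I_def min_def max_def split: if_splits)
      qed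
      have "P tagged_partial_division_of (cbox (-real m) (real m))"
        unfolding tagged_partial_division_of_def
      proof (intro conjI allI impI)
        show "finite P" using J by (simp add: P_def)
      next
        fix x L assume "(x, L) \<in> P"
        then obtain i where i: "i \<in> J" "x = fst i" "L = I i" by (auto simp: P_def)
        show "x \<in> L" using i by (cases i) (auto simp: I_def)
        show "L \<subseteq> cbox (-real m) (real m)" using i JK unfolding K_def by fastforce
        show "\<exists>a b. L = cbox a b" using i by (cases i) (auto simp: I_def)
      next
        fix x1 K1 x2 K2 assume *: "(x1, K1) \<in> P \<and> (x2, K2) \<in> P \<and> (x1, K1) \<noteq> (x2, K2)"
        then obtain i j where ij: "i \<in> J" "K1 = I i" "j \<in> J" "K2 = I j" "i \<noteq> j"
          by (auto simp: P_def)
        then have "disjnt K1 K2"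
          using C(3) J unfolding pairwise_def cb by blast
        then show "interior K1 \<inter> interior K2 = {}"
          using interior_subset unfolding disjnt_def by blast
      qed
      moreover have "\<gamma> fine P"
        unfolding fine_def P_def using JK unfolding K_def by fastforce
      ultimately have "(\<Sum>(x, k)\<in>P. norm (measure lborel k *\<^sub>R g x - integral k g)) < e'"
        by (rule \<gamma>)
      then have less: "(\<Sum>i\<in>J. \<bar>measure lborel (I i) * g (fst i) - integral (I i) g\<bar>) < e'"
        unfolding P_def by (simp add: sum.reindex[OF inj])
      have "measure lebesgue (\<Union>i\<in>J. I i) \<le> (\<Sum>i\<in>J. measure lebesgue (I i))"
        using J fm by (intro measure_UNION_le) auto
      also have "\<dots> \<le> (\<Sum>i\<in>J. real (Suc n) * \<bar>measure lborel (I i) * g (fst i) - integral (I i) g\<bar>)"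
      proof (rule sum_mono)
        fix i assume "i \<in> J"
        then obtain t y where i: "i = (t, y)" "(t, y) \<in> K" using JK by (cases i) auto
        \<comment> \<open>The tag may be the left or the right endpoint, which only changes the sign
          of the error.\<close>
        have "\<bar>measure lborel (I i) * g t - integral (I i) g\<bar> = \<bar>F y - F t - g t * (y - t)\<bar>"
        proof (cases "t \<le> y")
          case True
          then have "measure lborel (I i) * g t - integral (I i) g = - (F y - F t - g t * (y - t))"
            using F[of t y] i by (simp add: I_def algebra_simps)
          then show ?thesis by linarith
        next
          case False
          then have "measure lborel (I i) * g t - integral (I i) g = F y - F t - g t * (y - t)"
            using F[of y t] i by (simp add: I_def algebra_simps)
          then show ?thesis by linarith
        qed
        moreover have "measure lebesgue (I i) = \<bar>y - t\<bar>"
          using i by (auto simp: I_def min_def max_def)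
        moreover have "\<bar>y - t\<bar> / real (Suc n) < \<bar>F y - F t - g t * (y - t)\<bar>"
          using i by (auto simp: K_def)
        ultimately show "measure lebesgue (I i) \<le> real (Suc n) * \<bar>measure lborel (I i) * g (fst i) - integral (I i) g\<bar>"
          using i by (simp add: field_simps)
      qed
      also have "\<dots> \<le> e"
        unfolding sum_distrib_left[symmetric]
        using less by (simp add: e'_def pos_less_divide_eq mult.commute del: of_nat_Suc)
      finally show ?thesis .
    qed
    have fmU: "(\<Union>i\<in>C. I i) \<in> lmeasurable" and mU: "measure lebesgue (\<Union>i\<in>C. I i) \<le> e"
      using fmeasurable_UN_bound[OF C(1) fm bound] measure_UN_bound[OF C(1) fm bound] by auto
    define Z where "Z = ?S - (\<Union>i\<in>C. I i)"
    have Z: "negligible Z" using C(4) unfolding cb Z_def .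
    show "\<exists>T. ?S \<subseteq> T \<and> T \<in> lmeasurable \<and> measure lebesgue T \<le> e"
    proof (intro exI conjI)
      show "?S \<subseteq> Z \<union> (\<Union>i\<in>C. I i)" by (auto simp: Z_def)
      show "Z \<union> (\<Union>i\<in>C. I i) \<in> lmeasurable"
        using fmU by (rule fmeasurable.Un[OF negligible_imp_measurable[OF Z]])
      have "measure lebesgue (Z \<union> (\<Union>i\<in>C. I i)) \<le> measure lebesgue Z + measure lebesgue (\<Union>i\<in>C. I i)"
        using Z fmU by (intro measure_Un_le) (auto simp: negligible_imp_sets)
      then show "measure lebesgue (Z \<union> (\<Union>i\<in>C. I i)) \<le> e"
        using mU Z by (simp add: negligible_imp_measure0)
    qed
  qed
  have "negligible (\<Union>n m. E n \<inter> {-real m<..<real m})"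
    by (rule negligible_Union_nat, rule negligible_Union_nat, rule neg)
  moreover have "{t. \<not> (F has_real_derivative g t) (at t)} \<subseteq> (\<Union>n m. E n \<inter> {-real m<..<real m})"
  proof
    fix t assume "t \<in> {t. \<not> (F has_real_derivative g t) (at t)}"
    then have t: "\<not> (F has_real_derivative g t) (at t)" by simp
    obtain m :: nat where m: "\<bar>t\<bar> < real m" using reals_Archimedean2 by blast
    have "\<exists>n. t \<in> E n"
    proof (rule ccontr)
      assume no: "\<nexists>n. t \<in> E n"
      have "(F has_derivative (*) (g t)) (at t)"
        unfolding has_derivative_at_alt
      proof (intro conjI allI impI)
        show "bounded_linear ((*) (g t))" by (rule bounded_linear_mult_right)
        fix e :: real assume "e > 0"
        then obtain n where n: "1 / real (Suc n) < e" using nat_approx_posE by blast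
        have "t \<notin> E n" using no by blast
        then obtain d where "d > 0" and d: "\<And>y. y \<noteq> t \<Longrightarrow> \<bar>y - t\<bar> < d \<Longrightarrow>
            \<bar>F y - F t - g t * (y - t)\<bar> \<le> \<bar>y - t\<bar> / real (Suc n)"
          unfolding E_def mem_Collect_eq by (meson not_le)
        have "norm (F y - F t - g t * (y - t)) \<le> e * norm (y - t)" if "norm (y - t) < d" for y
        proof (cases "y = t")
          case False
          then have "\<bar>F y - F t - g t * (y - t)\<bar> \<le> 1 / real (Suc n) * \<bar>y - t\<bar>"
            using d[of y] that by simp
          also have "\<dots> \<le> e * \<bar>y - t\<bar>"
            using n by (intro mult_right_mono) auto
          finally show ?thesis by simp
        qed simp
        with \<open>d > 0\<close> show "\<exists>d>0. \<forall>y. norm (y - t) < d \<longrightarrow> norm (F y - F t - g t * (y - t)) \<le> e * norm (y - t)"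
          by blast
      qed
      then show False
        using t unfolding has_field_derivative_def by simp
    qed
    moreover have "- real m < t \<and> t < real m" using m by linarith
    ultimately show "t \<in> (\<Union>n m. E n \<inter> {-real m<..<real m})"
      by auto
  qed
  ultimately show ?thesis by (rule negligible_subset)
qed

section \<open>Closure properties of absolutely continuous functions\<close>

lemma abs_continuous_onD:
  assumes "abs_continuous_on p q f" "\<epsilon> > 0"
  obtains \<delta> where "\<delta> > 0"
    "\<And>D. finite D \<Longrightarrow> (\<forall>(l, r) \<in> D. p \<le> l \<and> l \<le> r \<and> r \<le> q) \<Longrightarrow>
      disjoint_family_on (\<lambda>(l, r). {l<..<r}) D \<Longrightarrow> (\<Sum>(l, r) \<in> D. r - l) < \<delta> \<Longrightarrow>
      (\<Sum>(l, r) \<in> D. \<bar>f r - f l\<bar>) < \<epsilon>"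
  using assms unfolding abs_continuous_on_def by meson

lemma locally_abs_continuous_const: "locally_abs_continuous (\<lambda>_. c)"
  unfolding locally_abs_continuous_def abs_continuous_on_def
  by (auto simp: split_def intro: exI[of _ 1])

text \<open>One argument serves sums, with \<open>C = 1\<close>, and products, with \<open>C\<close>
  bounding both factors. Allotting \<open>\<epsilon> / (2 * C)\<close> to each of \<open>f\<close>
  and \<open>g\<close> makes the two weighted sums fit into \<open>\<epsilon>\<close>.\<close>

lemma abs_continuous_on_dominated:
  assumes f: "abs_continuous_on p q f" and g: "abs_continuous_on p q g" and "C > 0"
    and dom: "\<And>l r. p \<le> l \<Longrightarrow> l \<le> r \<Longrightarrow> r \<le> q \<Longrightarrow>
      \<bar>k r - k l\<bar> \<le> C * \<bar>f r - f l\<bar> + C * \<bar>g r - g l\<bar>"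
  shows "abs_continuous_on p q k"
  unfolding abs_continuous_on_def
proof (intro allI impI)
  fix \<epsilon> :: real assume "\<epsilon> > 0"
  then have e: "\<epsilon> / (2 * C) > 0" using \<open>C > 0\<close> by simp
  obtain d1 where d1: "d1 > 0"
    "\<And>D. finite D \<Longrightarrow> (\<forall>(l, r) \<in> D. p \<le> l \<and> l \<le> r \<and> r \<le> q) \<Longrightarrow>
      disjoint_family_on (\<lambda>(l, r). {l<..<r}) D \<Longrightarrow> (\<Sum>(l, r) \<in> D. r - l) < d1 \<Longrightarrow>
      (\<Sum>(l, r) \<in> D. \<bar>f r - f l\<bar>) < \<epsilon> / (2 * C)"
    using abs_continuous_onD[OF f e] by blast
  obtain d2 where d2: "d2 > 0"
    "\<And>D. finite D \<Longrightarrow> (\<forall>(l, r) \<in> D. p \<le> l \<and> l \<le> r \<and> r \<le> q) \<Longrightarrow>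
      disjoint_family_on (\<lambda>(l, r). {l<..<r}) D \<Longrightarrow> (\<Sum>(l, r) \<in> D. r - l) < d2 \<Longrightarrow>
      (\<Sum>(l, r) \<in> D. \<bar>g r - g l\<bar>) < \<epsilon> / (2 * C)"
    using abs_continuous_onD[OF g e] by blast
  show "\<exists>\<delta>>0. \<forall>D. finite D \<longrightarrow> (\<forall>(l, r) \<in> D. p \<le> l \<and> l \<le> r \<and> r \<le> q) \<longrightarrow>
      disjoint_family_on (\<lambda>(l, r). {l<..<r}) D \<longrightarrow> (\<Sum>(l, r) \<in> D. r - l) < \<delta> \<longrightarrow>
      (\<Sum>(l, r) \<in> D. \<bar>k r - k l\<bar>) < \<epsilon>"
  proof (intro exI[of _ "min d1 d2"] conjI allI impI)
    fix D :: "(real \<times> real) set"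
    assume D: "finite D" "\<forall>(l, r) \<in> D. p \<le> l \<and> l \<le> r \<and> r \<le> q"
      "disjoint_family_on (\<lambda>(l, r). {l<..<r}) D" "(\<Sum>(l, r) \<in> D. r - l) < min d1 d2"
    have "(\<Sum>(l, r) \<in> D. \<bar>k r - k l\<bar>) \<le> (\<Sum>(l, r) \<in> D. C * \<bar>f r - f l\<bar> + C * \<bar>g r - g l\<bar>)"
      using D(2) dom by (intro sum_mono) auto
    also have "\<dots> = C * (\<Sum>(l, r) \<in> D. \<bar>f r - f l\<bar>) + C * (\<Sum>(l, r) \<in> D. \<bar>g r - g l\<bar>)"
      by (simp add: split_def sum.distrib sum_distrib_left)
    also have "\<dots> < C * (\<epsilon> / (2 * C)) + C * (\<epsilon> / (2 * C))"
      using d1(2)[OF D(1-3)] d2(2)[OF D(1-3)] D(4) \<open>C > 0\<close>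
      by (intro add_strict_mono mult_strict_left_mono) auto
    also have "\<dots> = \<epsilon>" using \<open>C > 0\<close> by simp
    finally show "(\<Sum>(l, r) \<in> D. \<bar>k r - k l\<bar>) < \<epsilon>" .
  qed (use d1 d2 in auto)
qed

lemma locally_abs_continuous_add:
  assumes "locally_abs_continuous f" "locally_abs_continuous g"
  shows "locally_abs_continuous (\<lambda>t. f t + g t)"
  unfolding locally_abs_continuous_def
proof (intro allI)
  fix p q
  show "abs_continuous_on p q (\<lambda>t. f t + g t)"
    by (rule abs_continuous_on_dominated[of p q f g 1])
       (use assms in \<open>auto simp: locally_abs_continuous_def\<close>)
qed

text \<open>A single interval is an admissible family, so the \<open>\<delta>\<close> of absolute
  continuity near \<open>t\<close>, capped at \<open>1\<close>, serves for continuity at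
  \<open>t\<close>.\<close>

lemma locally_abs_continuous_imp_continuous_on:
  assumes "locally_abs_continuous f"
  shows "continuous_on S f"
proof -
  have "isCont f t" for t
    unfolding continuous_at_eps_delta
  proof (intro allI impI)
    fix e :: real assume "e > 0"
    have "abs_continuous_on (t - 1) (t + 1) f"
      using assms by (simp add: locally_abs_continuous_def)
    then obtain \<delta> where \<delta>: "\<delta> > 0"
      "\<And>D. finite D \<Longrightarrow> (\<forall>(l, r) \<in> D. t - 1 \<le> l \<and> l \<le> r \<and> r \<le> t + 1) \<Longrightarrow>
        disjoint_family_on (\<lambda>(l, r). {l<..<r}) D \<Longrightarrow> (\<Sum>(l, r) \<in> D. r - l) < \<delta> \<Longrightarrow>
        (\<Sum>(l, r) \<in> D. \<bar>f r - f l\<bar>) < e"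
      using abs_continuous_onD[OF _ \<open>e > 0\<close>] by blast
    show "\<exists>d>0. \<forall>y. dist y t < d \<longrightarrow> dist (f y) (f t) < e"
    proof (intro exI[of _ "min \<delta> 1"] conjI allI impI)
      fix y assume y: "dist y t < min \<delta> 1"
      have "(\<Sum>(l, r) \<in> {(min y t, max y t)}. \<bar>f r - f l\<bar>) < e"
        by (rule \<delta>(2)) (use y in \<open>auto simp: dist_real_def disjoint_family_on_def\<close>)
      then show "dist (f y) (f t) < e"
        by (auto simp: dist_real_def min_def max_def abs_minus_commute split: if_splits)
    qed (use \<delta> in auto)
  qed
  then show ?thesis
    using continuous_at_imp_continuous_on by blast
qed

text \<open>Both factors are bounded on \<open>{p..q}\<close> by continuity, and the increment of
  the product is a combination of the increments of the factors with bounded coefficients.\<close>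

lemma locally_abs_continuous_mult:
  assumes "locally_abs_continuous f" "locally_abs_continuous g"
  shows "locally_abs_continuous (\<lambda>t. f t * g t)"
  unfolding locally_abs_continuous_def
proof (intro allI)
  fix p q
  have "bounded (f ` {p..q})" "bounded (g ` {p..q})"
    using assms by (auto intro!: compact_imp_bounded compact_continuous_image locally_abs_continuous_imp_continuous_on)
  then obtain A B where A: "A > 0" "\<And>x. x \<in> {p..q} \<Longrightarrow> \<bar>f x\<bar> \<le> A"
    and B: "B > 0" "\<And>x. x \<in> {p..q} \<Longrightarrow> \<bar>g x\<bar> \<le> B"
    by (auto simp: bounded_pos)
  show "abs_continuous_on p q (\<lambda>t. f t * g t)"
  proof (rule abs_continuous_on_dominated[of p q f g "max A B"])
    fix l r assume lr: "p \<le> l" "l \<le> r" "r \<le> q"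
    have "\<bar>f r * g r - f l * g l\<bar> = \<bar>g r * (f r - f l) + f l * (g r - g l)\<bar>"
      by (simp add: algebra_simps)
    also have "\<dots> \<le> \<bar>g r\<bar> * \<bar>f r - f l\<bar> + \<bar>f l\<bar> * \<bar>g r - g l\<bar>"
      unfolding abs_mult[symmetric] by (rule abs_triangle_ineq)
    also have "\<dots> \<le> max A B * \<bar>f r - f l\<bar> + max A B * \<bar>g r - g l\<bar>"
      using A(2)[of l] B(2)[of r] lr by (intro add_mono mult_right_mono) auto
    finally show "\<bar>f r * g r - f l * g l\<bar> \<le> max A B * \<bar>f r - f l\<bar> + max A B * \<bar>g r - g l\<bar>" .
  qed (use assms A in \<open>auto simp: locally_abs_continuous_def\<close>)
qed

lemma locally_abs_continuous_diff:
  assumes "locally_abs_continuous f" "locally_abs_continuous g"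
  shows "locally_abs_continuous (\<lambda>t. f t - g t)"
  using locally_abs_continuous_add[OF assms(1)
    locally_abs_continuous_mult[OF locally_abs_continuous_const[of "-1"] assms(2)]] by simp

text \<open>The map \<open>(l, r) \<mapsto> (- r, - l)\<close> preserves lengths and disjointness
  and carries families in \<open>{p..q}\<close> to families in \<open>{- q..- p}\<close>.\<close>

lemma locally_abs_continuous_reflect:
  assumes "locally_abs_continuous f"
  shows "locally_abs_continuous (\<lambda>t. f (- t))"
  unfolding locally_abs_continuous_def abs_continuous_on_def
proof (intro allI impI)
  fix p q \<epsilon> :: real assume "\<epsilon> > 0"
  have "abs_continuous_on (- q) (- p) f"
    using assms by (simp add: locally_abs_continuous_def)
  then obtain \<delta> where \<delta>: "\<delta> > 0"
    "\<And>D. finite D \<Longrightarrow> (\<forall>(l, r) \<in> D. - q \<le> l \<and> l \<le> r \<and> r \<le> - p) \<Longrightarrow>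
      disjoint_family_on (\<lambda>(l, r). {l<..<r}) D \<Longrightarrow> (\<Sum>(l, r) \<in> D. r - l) < \<delta> \<Longrightarrow>
      (\<Sum>(l, r) \<in> D. \<bar>f r - f l\<bar>) < \<epsilon>"
    using abs_continuous_onD[OF _ \<open>\<epsilon> > 0\<close>] by blast
  show "\<exists>\<delta>>0. \<forall>D. finite D \<longrightarrow> (\<forall>(l, r) \<in> D. p \<le> l \<and> l \<le> r \<and> r \<le> q) \<longrightarrow>
      disjoint_family_on (\<lambda>(l, r). {l<..<r}) D \<longrightarrow> (\<Sum>(l, r) \<in> D. r - l) < \<delta> \<longrightarrow>
      (\<Sum>(l, r) \<in> D. \<bar>f (- r) - f (- l)\<bar>) < \<epsilon>"
  proof (intro exI[of _ \<delta>] conjI allI impI)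
    fix D :: "(real \<times> real) set"
    assume D: "finite D" "\<forall>(l, r) \<in> D. p \<le> l \<and> l \<le> r \<and> r \<le> q"
      "disjoint_family_on (\<lambda>(l, r). {l<..<r}) D" "(\<Sum>(l, r) \<in> D. r - l) < \<delta>"
    define \<phi> where "\<phi> = (\<lambda>(l, r). (- r, - l) :: real \<times> real)"
    have inj: "inj_on \<phi> D"
      by (auto simp: inj_on_def \<phi>_def)
    have "disjoint_family_on (\<lambda>(l, r). {l<..<r}) (\<phi> ` D)"
      unfolding disjoint_family_on_def
    proof (intro ballI impI)
      fix m n assume "m \<in> \<phi> ` D" "n \<in> \<phi> ` D" "m \<noteq> n"
      then obtain i j where ij: "i \<in> D" "j \<in> D" "i \<noteq> j" "m = \<phi> i" "n = \<phi> j" by auto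
      then have "(case i of (l, r) \<Rightarrow> {l<..<r}) \<inter> (case j of (l, r) \<Rightarrow> {l<..<r}) = {}"
        using D(3) by (simp add: disjoint_family_on_def)
      then show "(case m of (l, r) \<Rightarrow> {l<..<r}) \<inter> (case n of (l, r) \<Rightarrow> {l<..<r}) = {}"
        using ij by (cases i; cases j) (simp add: \<phi>_def)
    qed
    moreover have "(\<Sum>(l, r) \<in> \<phi> ` D. r - l) < \<delta>"
      using D(4) unfolding sum.reindex[OF inj] by (simp add: \<phi>_def split_def comp_def)
    ultimately have "(\<Sum>(l, r) \<in> \<phi> ` D. \<bar>f r - f l\<bar>) < \<epsilon>"
      using D(1,2) by (intro \<delta>(2)) (auto simp: \<phi>_def)
    then show "(\<Sum>(l, r) \<in> D. \<bar>f (- r) - f (- l)\<bar>) < \<epsilon>"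
      unfolding sum.reindex[OF inj] by (simp add: \<phi>_def split_def comp_def abs_minus_commute)
  qed (use \<delta> in auto)
qed

section \<open>Indefinite integrals and the fundamental theorem of calculus\<close>

text \<open>Cut \<open>\<bar>g\<bar>\<close> at height \<open>n\<close>: the part below contributes
  at most \<open>n\<close> times the total length, and the integral of the excess \<open>k n\<close>
  tends to \<open>0\<close> by dominated convergence.\<close>

lemma locally_abs_continuous_indefinite_integral:
  fixes F g :: "real \<Rightarrow> real"
  assumes int: "\<And>p q. g absolutely_integrable_on {p..q}"
    and F: "\<And>x y. x \<le> y \<Longrightarrow> F y - F x = integral {x..y} g"
  shows "locally_abs_continuous F"
  unfolding locally_abs_continuous_def abs_continuous_on_def
proof (intro allI impI)
  fix p q \<epsilon> :: real assume "\<epsilon> > 0"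
  define \<phi> where "\<phi> s = indicator {p..q} s * g s" for s :: real
  have \<phi>: "integrable lebesgue \<phi>"
    using int[of p q] unfolding \<phi>_def set_integrable_def by simp
  define k where "k n s = max (\<bar>\<phi> s\<bar> - real n) 0" for n s
  have [measurable]: "\<phi> \<in> borel_measurable lebesgue" using \<phi> by auto
  have km: "k n \<in> borel_measurable lebesgue" for n
    unfolding k_def by measurable
  have k: "integrable lebesgue (k n)" for n
    by (rule Bochner_Integration.integrable_bound[OF \<phi> km]) (auto simp: k_def)
  have "(\<lambda>n. integral\<^sup>L lebesgue (k n)) \<longlonglongrightarrow> (LINT s::real|lebesgue. (0::real))"
  proof (rule integral_dominated_convergence[where w = "\<lambda>s. \<bar>\<phi> s\<bar>"])
    show "AE s in lebesgue. (\<lambda>n. k n s) \<longlonglongrightarrow> 0"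
    proof (rule AE_I2)
      fix s
      obtain N where N: "\<bar>\<phi> s\<bar> < real N" using reals_Archimedean2 by blast
      show "(\<lambda>n. k n s) \<longlonglongrightarrow> 0"
        by (rule tendsto_eventually)
           (use N in \<open>auto simp: k_def eventually_sequentially intro!: exI[of _ N]\<close>)
    qed
  qed (use \<phi> km in \<open>auto simp: k_def\<close>)
  then have "eventually (\<lambda>n. integral\<^sup>L lebesgue (k n) < \<epsilon> / 2) sequentially"
    using \<open>\<epsilon> > 0\<close> by (intro order_tendstoD(2)[where y = 0]) auto
  then obtain n where n: "integral\<^sup>L lebesgue (k n) < \<epsilon> / 2"
    by (auto simp: eventually_sequentially)
  \<comment> \<open>Gives \<open>real n * \<delta> \<le> \<epsilon> / 2\<close>;
    \<open>Suc n\<close> keeps \<open>\<delta>\<close> positive when \<open>n = 0\<close>.\<close>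
  define \<delta> where "\<delta> = \<epsilon> / (2 * real (Suc n))"
  show "\<exists>\<delta>>0. \<forall>D. finite D \<longrightarrow> (\<forall>(l, r) \<in> D. p \<le> l \<and> l \<le> r \<and> r \<le> q) \<longrightarrow>
      disjoint_family_on (\<lambda>(l, r). {l<..<r}) D \<longrightarrow> (\<Sum>(l, r) \<in> D. r - l) < \<delta> \<longrightarrow>
      (\<Sum>(l, r) \<in> D. \<bar>F r - F l\<bar>) < \<epsilon>"
  proof (intro exI[of _ \<delta>] conjI allI impI)
    fix D :: "(real \<times> real) set"
    assume D: "finite D" "\<forall>(l, r) \<in> D. p \<le> l \<and> l \<le> r \<and> r \<le> q"
      "disjoint_family_on (\<lambda>(l, r). {l<..<r}) D" "(\<Sum>(l, r) \<in> D. r - l) < \<delta>"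
    define \<iota> where "\<iota> = (\<lambda>(l :: real, r). indicat_real {l<..<r})"
    have \<iota>k: "integrable lebesgue (\<lambda>s. \<iota> i s * k n s)" for i
      using integrable_mult_indicator[OF _ k, of "{fst i<..<snd i}" n] by (simp add: \<iota>_def split_def)
    have \<iota>n: "integrable lebesgue (\<lambda>s. real n * \<iota> i s)" for i
    proof -
      have "{fst i<..<snd i} \<in> lmeasurable"
        using lmeasurable_box[of "fst i" "snd i"] by simp
      then have "integrable lebesgue (indicat_real {fst i<..<snd i})"
        by (intro integrable_real_indicator fmeasurableD) (auto simp: fmeasurable_def)
      then show ?thesis
        by (simp add: \<iota>_def split_def)
    qed
    have each: "\<bar>F r - F l\<bar> \<le> real n * (r - l) + (LINT s|lebesgue. \<iota> (l, r) s * k n s)"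
      if "(l, r) \<in> D" for l r
    proof -
      have lr: "p \<le> l" "l \<le> r" "r \<le> q" using D(2) that by auto
      have si: "set_integrable lebesgue {l<..<r} g"
        by (rule set_integrable_subset[OF int[of l r]]) auto
      have "F r - F l = (LINT s:{l<..<r}|lebesgue. g s)"
        using F[OF lr(2)] set_lebesgue_integral_eq_integral(2)[OF si]
        by (simp add: integral_open_interval_real)
      also have "\<bar>\<dots>\<bar> \<le> (LINT s|lebesgue. real n * \<iota> (l, r) s + \<iota> (l, r) s * k n s)"
        unfolding set_lebesgue_integral_def real_norm_def[symmetric]
      proof (rule Bochner_Integration.integral_norm_bound_integral)
        show "integrable lebesgue (\<lambda>s. indicat_real {l<..<r} s *\<^sub>R g s)"
          using si unfolding set_integrable_def .
        show "integrable lebesgue (\<lambda>s. real n * \<iota> (l, r) s + \<iota> (l, r) s * k n s)"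
          using \<iota>k \<iota>n by (rule Bochner_Integration.integrable_add[rotated])
        show "norm (indicat_real {l<..<r} s *\<^sub>R g s) \<le> real n * \<iota> (l, r) s + \<iota> (l, r) s * k n s" for s
          using lr by (auto simp: \<iota>_def k_def \<phi>_def indicator_def)
      qed
      also have "\<dots> = (LINT s|lebesgue. real n * \<iota> (l, r) s) + (LINT s|lebesgue. \<iota> (l, r) s * k n s)"
        by (rule Bochner_Integration.integral_add[OF \<iota>n \<iota>k])
      also have "(LINT s|lebesgue. real n * \<iota> (l, r) s) = real n * (r - l)"
        using lr by (simp add: \<iota>_def)
      finally show ?thesis .
    qed
    \<comment> \<open>By disjointness at most one indicator is nonzero at \<open>s\<close>, so the
      excesses over all of \<open>D\<close> together cost a single integral of
      \<open>k n\<close>.\<close>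
    have sum_le1: "(\<Sum>i\<in>D. \<iota> i s) \<le> 1" for s
    proof (cases "\<exists>i\<in>D. s \<in> (\<lambda>(l, r). {l<..<r}) i")
      case True
      then obtain i where i: "i \<in> D" "s \<in> (\<lambda>(l, r). {l<..<r}) i" by blast
      have "\<iota> j s = 0" if "j \<in> D - {i}" for j
        using disjoint_family_onD[OF D(3), of i j] i that by (cases i; cases j) (auto simp: \<iota>_def indicator_def)
      then have "(\<Sum>i\<in>D. \<iota> i s) = \<iota> i s"
        using i(1) D(1) by (simp add: sum.remove)
      then show ?thesis by (simp add: \<iota>_def split_def)
    next
      case False
      then have "(\<Sum>i\<in>D. \<iota> i s) = 0"
        by (intro sum.neutral) (auto simp: \<iota>_def split_def)
      then show ?thesis by simp
    qed
    have "(\<Sum>(l, r)\<in>D. \<bar>F r - F l\<bar>) \<le> (\<Sum>(l, r)\<in>D. real n * (r - l) + (LINT s|lebesgue. \<iota> (l, r) s * k n s))"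
      using each by (intro sum_mono) auto
    also have "\<dots> = real n * (\<Sum>(l, r)\<in>D. r - l) + (LINT s|lebesgue. (\<Sum>i\<in>D. \<iota> i s * k n s))"
      using \<iota>k by (subst Bochner_Integration.integral_sum) (auto simp: split_def sum.distrib sum_distrib_left)
    also have "(LINT s|lebesgue. (\<Sum>i\<in>D. \<iota> i s * k n s)) \<le> integral\<^sup>L lebesgue (k n)"
    proof (rule integral_mono)
      show "integrable lebesgue (\<lambda>s. \<Sum>i\<in>D. \<iota> i s * k n s)"
        using \<iota>k by simp
      show "(\<Sum>i\<in>D. \<iota> i s * k n s) \<le> k n s" for s
        using mult_right_mono[OF sum_le1[of s], of "k n s"] by (simp add: sum_distrib_right k_def)
    qed (rule k)
    also have "real n * (\<Sum>(l, r)\<in>D. r - l) \<le> real n * \<delta>"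
      using D(4) by (intro mult_left_mono) auto
    also have "real n * \<delta> \<le> \<epsilon> / 2"
      using \<open>\<epsilon> > 0\<close> by (simp add: \<delta>_def field_simps)
    finally show "(\<Sum>(l, r)\<in>D. \<bar>F r - F l\<bar>) < \<epsilon>"
      using n by simp
  qed (use \<open>\<epsilon> > 0\<close> in \<open>simp add: \<delta>_def\<close>)
qed

text \<open>Connects the oriented Lebesgue integrals of the definitions with the Henstock-Kurzweil
  integrals of the preceding results. The cases follow the position of \<open>0\<close> relative to
  \<open>x\<close> and \<open>y\<close>.\<close>

lemma interval_lebesgue_integral_diff_eq_integral:
  fixes g :: "real \<Rightarrow> real"
  assumes int: "\<And>p q. g absolutely_integrable_on {p..q}" and "x \<le> y"
  shows "(LINT s=0..y|lebesgue. g s) - (LINT s=0..x|lebesgue. g s) = integral {x..y} g"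
proof -
  have si: "(LINT s:{a<..<b}|lebesgue. g s) = integral {a..b} g" for a b
    unfolding integral_open_interval_real
    by (rule set_lebesgue_integral_eq_integral(2)[OF set_integrable_subset[OF int[of a b]]]) auto
  have J: "(LINT s=0..t|lebesgue. g s) = (if 0 \<le> t then integral {0..t} g else - integral {t..0} g)" for t
    by (simp add: interval_lebesgue_integral_def zero_ereal_def si)
  have g: "g integrable_on {a..b}" for a b
    using int[of a b] set_lebesgue_integral_eq_integral(1) by blast
  note comb = Henstock_Kurzweil_Integration.integral_combine[OF _ _ g]
  consider "0 \<le> x" | "x < 0" "0 \<le> y" | "y < 0" by linarith
  then show ?thesis
    using comb[of 0 x y] comb[of x 0 y] comb[of x y 0] \<open>x \<le> y\<close>
    by cases (auto simp: J)
qed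

lemma interval_lebesgue_integral_0_ereal_0: "(LINT s=0..ereal 0|M. g s) = 0"
  by (simp add: interval_lebesgue_integral_def set_lebesgue_integral_def einterval_def flip: zero_ereal_def)

lemma AE_lebesgue_iff_negligible: "(AE t in lebesgue. P t) \<longleftrightarrow> negligible {t. \<not> P t}"
  by (simp add: completion.AE_iff_null_sets negligible_iff_null_sets)

text \<open>Reflection is differentiable and therefore maps null sets to null sets.\<close>

lemma AE_lebesgue_reflect:
  fixes P :: "real \<Rightarrow> bool"
  assumes "AE t in lebesgue. P t"
  shows "AE t in lebesgue. P (- t)"
proof -
  have "negligible (uminus ` {t. \<not> P t})"
    using assms unfolding AE_lebesgue_iff_negligible
    by (intro negligible_differentiable_image_negligible) (auto intro!: derivative_intros)
  then show ?thesis
    unfolding AE_lebesgue_iff_negligible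
    by (rule negligible_subset) (force simp: image_iff)
qed

lemma locally_abs_continuous_interval_lebesgue_integral:
  fixes g :: "real \<Rightarrow> real"
  assumes int: "\<And>p q. g absolutely_integrable_on {p..q}"
  shows "locally_abs_continuous (\<lambda>t. LINT s=0..t|lebesgue. g s)"
  using int interval_lebesgue_integral_diff_eq_integral[OF int]
  by (rule locally_abs_continuous_indefinite_integral)

lemma AE_interval_lebesgue_integral_has_derivative:
  fixes g :: "real \<Rightarrow> real"
  assumes int: "\<And>p q. g absolutely_integrable_on {p..q}"
  shows "AE t in lebesgue. ((\<lambda>t. LINT s=0..t|lebesgue. g s) has_real_derivative g t) (at t)"
  unfolding AE_lebesgue_iff_negligible
  by (rule negligible_not_has_derivative_integrand)
     (use int set_lebesgue_integral_eq_integral(1) interval_lebesgue_integral_diff_eq_integral[OF int] in blast)+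

text \<open>Subtracting the integral from \<open>f\<close> leaves a locally absolutely continuous
  function with zero derivative almost everywhere, hence a constant.\<close>

lemma locally_abs_continuous_eq_interval_lebesgue_integral:
  fixes f g :: "real \<Rightarrow> real"
  assumes f: "locally_abs_continuous f" and int: "\<And>p q. g absolutely_integrable_on {p..q}"
    and der: "AE t in lebesgue. (f has_real_derivative g t) (at t)"
  shows "f t = f 0 + (LINT s=0..t|lebesgue. g s)"
proof -
  define k where "k t = f t - (LINT s=0..t|lebesgue. g s)" for t :: real
  have k: "locally_abs_continuous k"
    unfolding k_def by (intro locally_abs_continuous_diff f locally_abs_continuous_interval_lebesgue_integral int)
  have "AE t in lebesgue. (k has_real_derivative 0) (at t)"
    using der AE_interval_lebesgue_integral_has_derivative[OF int]
    unfolding k_def by eventually_elim (auto intro!: derivative_eq_intros)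
  then have "k p = k q" if "p \<le> q" for p q
    using abs_continuous_on_zero_derivative_imp_eq k that unfolding locally_abs_continuous_def by blast
  then have "k t = k 0" by (metis linear)
  then show ?thesis by (simp add: k_def interval_lebesgue_integral_0_ereal_0)
qed

text \<open>The sign records the reversed orientation. Both sides are differences from the base
  point \<open>0\<close>, so the reflection rule on closed intervals applies once the sign of
  \<open>t\<close> is known.\<close>

lemma interval_lebesgue_integral_reflect:
  fixes g :: "real \<Rightarrow> real"
  assumes int: "\<And>p q. g absolutely_integrable_on {p..q}"
  shows "(LINT s=0..t|lebesgue. g (- s)) = - (LINT s=0..ereal (- t)|lebesgue. g s)"
proof -
  have refl: "(\<lambda>s. g (- s)) absolutely_integrable_on {p..q}" for p q
    using has_absolute_integral_reflect_real[of "{p..q}" "{- q..- p}" g] int by auto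
  show ?thesis
    using interval_lebesgue_integral_diff_eq_integral[OF int, of "- t" 0]
      interval_lebesgue_integral_diff_eq_integral[OF int, of 0 "- t"]
      interval_lebesgue_integral_diff_eq_integral[OF refl, of t 0]
      interval_lebesgue_integral_diff_eq_integral[OF refl, of 0 t]
      Henstock_Kurzweil_Integration.integral_reflect_real[of t 0 g]
      Henstock_Kurzweil_Integration.integral_reflect_real[of 0 "- t" g]
      Henstock_Kurzweil_Integration.integral_reflect_real[of "- t" 0 g]
    by (cases "t \<le> 0") (simp_all add: interval_lebesgue_integral_0_ereal_0)
qed

subsection \<open>The reflection equation\<close>

lemma continuous_mult_integrable_absolutely_integrable_on:
  fixes f h :: "real \<Rightarrow> real"
  assumes "continuous_on UNIV f" "integrable lebesgue h"
  shows "(\<lambda>s. f s * h s) absolutely_integrable_on {p..q}"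
proof (rule absolutely_integrable_bounded_measurable_product_real)
  have c: "continuous_on {p..q} f"
    using assms(1) continuous_on_subset by blast
  show "f \<in> borel_measurable (lebesgue_on {p..q})"
    using c by (intro continuous_imp_measurable_on_sets_lebesgue) auto
  show "bounded (f ` {p..q})"
    using c by (intro compact_imp_bounded compact_continuous_image) auto
  show "h absolutely_integrable_on {p..q}"
    unfolding set_integrable_def by (rule integrable_mult_indicator) (use assms in auto)
qed auto

lemma integrable_lebesgue_reflect:
  fixes h :: "real \<Rightarrow> real"
  assumes "integrable lebesgue h"
  shows "integrable lebesgue (\<lambda>s. h (- s))"
  using has_absolute_integral_reflect_real[of UNIV UNIV h] assms
  by (auto simp: set_integrable_def)

lemma absolutely_integrable_imp_interval_lebesgue_integrable:
  fixes f :: "real \<Rightarrow> real"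
  assumes "\<And>p q. f absolutely_integrable_on {p..q}"
  shows "interval_lebesgue_integrable lebesgue (ereal a) (ereal b) f"
proof -
  have "set_integrable lebesgue {p<..<q} f" for p q
    by (rule set_integrable_subset[OF assms[of p q]]) auto
  then show ?thesis by (simp add: interval_lebesgue_integrable_def)
qed

lemma interval_lebesgue_integral_lebesgue_reverse:
  "(LINT s=a..b|lebesgue. f s) = - (LINT s=b..a|lebesgue. f s :: real)"
  by (cases a b rule: linorder_cases)
     (auto simp: interval_lebesgue_integral_def set_lebesgue_integral_def einterval_same)

text \<open>The endpoint conventions of \<open>oriented_char\<close> differ from the open interval
  behind the oriented integral only on the null set \<open>{a, b}\<close>.\<close>

lemma oriented_char_integral:
  fixes f :: "real \<Rightarrow> real"
  assumes int: "\<And>p q. f absolutely_integrable_on {p..q}"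
  shows "integrable lebesgue (\<lambda>s. oriented_char a b s * f s)"
    and "(LINT s|lebesgue. oriented_char a b s * f s) = (LINT s=a..b|lebesgue. f s)"
proof -
  define k where "k s = (if a \<le> b then indicat_real {a<..<b} s * f s else - (indicat_real {b<..<a} s * f s))" for s
  have "set_integrable lebesgue {p<..<q} f" for p q
    by (rule set_integrable_subset[OF int[of p q]]) auto
  then have k: "integrable lebesgue k"
    unfolding k_def set_integrable_def by (cases "a \<le> b") auto
  have "negligible {a, b}" by simp
  then have ae: "AE s in lebesgue. oriented_char a b s * f s = k s"
    unfolding AE_lebesgue_iff_negligible
    by (rule negligible_subset) (auto simp: oriented_char_def k_def indicator_def)
  then have ae': "AE s in lebesgue. k s = oriented_char a b s * f s"
    by eventually_elim simp
  have m: "(\<lambda>s. oriented_char a b s * f s) \<in> borel_measurable lebesgue"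
    by (rule borel_measurable_AE[OF borel_measurable_integrable[OF k] ae'])
  show "integrable lebesgue (\<lambda>s. oriented_char a b s * f s)"
    by (rule integrable_cong_AE_imp[OF k m ae'])
  have "(LINT s|lebesgue. oriented_char a b s * f s) = (LINT s|lebesgue. k s)"
    by (rule integral_cong_AE[OF m borel_measurable_integrable[OF k] ae])
  also have "\<dots> = (LINT s=a..b|lebesgue. f s)"
    by (cases "a \<le> b") (auto simp: k_def interval_lebesgue_integral_def set_lebesgue_integral_def)
  finally show "(LINT s|lebesgue. oriented_char a b s * f s) = (LINT s=a..b|lebesgue. f s)" .
qed

section \<open>Reflected Wronskians\<close>

lemma is_solution_AE_has_derivative:
  assumes "is_solution a b h t0 c x"
  shows "AE t in lebesgue. (x has_real_derivative h t - a * x (- t) - b * x t) (at t)"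
proof -
  have "AE t in lebesgue. x differentiable (at t) \<and> deriv x t + a * x (- t) + b * x t = h t"
    using assms by (simp add: is_solution_def)
  then show ?thesis
  proof eventually_elim
    case (elim t)
    then have "(x has_real_derivative deriv x t) (at t)"
      by (simp add: DERIV_deriv_iff_real_differentiable)
    moreover have "deriv x t = h t - a * x (- t) - b * x t"
      using elim by linarith
    ultimately show ?case by simp
  qed
qed

lemma AE_has_derivative_reflect:
  fixes f g :: "real \<Rightarrow> real"
  assumes "AE t in lebesgue. (f has_real_derivative g t) (at t)"
  shows "AE t in lebesgue. ((\<lambda>t. f (- t)) has_real_derivative - g (- t)) (at t)"
  using AE_lebesgue_reflect[OF assms]
  by eventually_elim (simp add: DERIV_mirror)

text \<open>The sign \<open>\<sigma>\<close> covers both kernels: \<open>y = u\<close> for \<open>\<sigma> = 1\<close> and \<open>y = v\<close> for \<open>\<sigma> = - 1\<close>.\<close>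

lemma reflected_wronskian_eq:
  assumes x: "is_solution a b h t0 c x" and y: "is_solution (\<sigma> * a) b (\<lambda>_. 0) s0 d y"
    and \<sigma>: "\<sigma> = 1 \<or> \<sigma> = - 1" and h: "integrable lebesgue h"
  shows "y (- t) * x t - \<sigma> * y t * x (- t) = y 0 * x 0 - \<sigma> * y 0 * x 0 +
    (LINT s=0..t|lebesgue. (y (- s) * h s + \<sigma> * y s * h (- s)))"
proof -
  have lx: "locally_abs_continuous x" and ly: "locally_abs_continuous y"
    using x y by (auto simp: is_solution_def)
  have cont: "continuous_on UNIV (\<lambda>s. y (- s))" "continuous_on UNIV (\<lambda>s. \<sigma> * y s)"
    by (intro locally_abs_continuous_imp_continuous_on locally_abs_continuous_mult
        locally_abs_continuous_const locally_abs_continuous_reflect ly)+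
  have "AE t in lebesgue. ((\<lambda>t. y (- t) * x t - \<sigma> * y t * x (- t)) has_real_derivative
      y (- t) * h t + \<sigma> * y t * h (- t)) (at t)"
    using is_solution_AE_has_derivative[OF x] is_solution_AE_has_derivative[OF y]
      AE_has_derivative_reflect[OF is_solution_AE_has_derivative[OF x]]
      AE_has_derivative_reflect[OF is_solution_AE_has_derivative[OF y]]
  proof eventually_elim
    case (elim t)
    have "((\<lambda>t. y (- t) * x t - \<sigma> * y t * x (- t)) has_real_derivative
      (- (0 - \<sigma> * a * y (- (- t)) - b * y (- t)) * x t + (h t - a * x (- t) - b * x t) * y (- t)) -
      (\<sigma> * (0 - \<sigma> * a * y (- t) - b * y t) * x (- t) +
        - (h (- t) - a * x (- (- t)) - b * x (- t)) * (\<sigma> * y t))) (at t)"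
      by (intro DERIV_diff DERIV_mult DERIV_cmult elim)
    \<comment> \<open>The terms with \<open>b\<close> cancel because reflection flips the sign of a
      derivative, those with \<open>a\<close> because
      \<open>\<sigma> * \<sigma> = 1\<close>.\<close>
    then show ?case
      by (rule DERIV_cong) (use \<sigma> in \<open>auto simp: algebra_simps\<close>)
  qed
  moreover have "(\<lambda>s. y (- s) * h s + \<sigma> * y s * h (- s)) absolutely_integrable_on {p..q}" for p q
    using continuous_mult_integrable_absolutely_integrable_on cont h integrable_lebesgue_reflect[OF h]
    by (intro set_integral_add(1)) blast+
  moreover have "locally_abs_continuous (\<lambda>t. y (- t) * x t - \<sigma> * y t * x (- t))"
    by (intro locally_abs_continuous_diff locally_abs_continuous_mult
        locally_abs_continuous_const locally_abs_continuous_reflect lx ly)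
  ultimately show ?thesis
    using locally_abs_continuous_eq_interval_lebesgue_integral[of "\<lambda>t. y (- t) * x t - \<sigma> * y t * x (- t)"
        "\<lambda>s. y (- s) * h s + \<sigma> * y s * h (- s)" t] by simp
qed

section \<open>The Green function\<close>

text \<open>Up to the factor 1/2, the integrands of \<open>u0\<close> are the sources of the
  reflected Wronskians: that of \<open>v\<close> with \<open>\<sigma> = - 1\<close> and that of
  \<open>u\<close> with \<open>\<sigma> = 1\<close>.\<close>

lemma even_odd_products_eq:
  "odd_part h s * even_part v s - even_part h s * odd_part v s = (v (- s) * h s - v s * h (- s)) / 2"
  "even_part h s * even_part u s - odd_part h s * odd_part u s = (u (- s) * h s + u s * h (- s)) / 2"
  by (simp_all add: odd_part_def even_part_def field_simps)

lemma u0_eq: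
  "u0 h u v t = (u t * (LINT s=0..t|lebesgue. (v (- s) * h s - v s * h (- s))) +
    v t * (LINT s=0..t|lebesgue. (u (- s) * h s + u s * h (- s)))) / 2"
  unfolding u0_def even_odd_products_eq interval_lebesgue_integral_divide by (simp only: times_divide_eq_right add_divide_distrib)

text \<open>The part of \<open>G\<close> on the oriented interval from \<open>0\<close> to
  \<open>t\<close> yields the terms of \<open>u0\<close> with \<open>h s\<close>; the part from
  \<open>- t\<close> to \<open>0\<close>, once reflected, yields those with
  \<open>h (- s)\<close>.\<close>

lemma G_integral:
  assumes h: "integrable lebesgue h" and u: "continuous_on UNIV u" and v: "continuous_on UNIV v"
  shows "integrable lebesgue (\<lambda>s. G u v t s * h s)"
    and "(LINT s|lebesgue. G u v t s * h s) = u0 h u v t"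
proof -
  have ur: "continuous_on UNIV (\<lambda>s. u (- s))" and vr: "continuous_on UNIV (\<lambda>s. v (- s))"
    by (rule continuous_on_compose2[OF _ continuous_on_minus[OF continuous_on_id]], rule u v, simp)+
  note hr = integrable_lebesgue_reflect[OF h]
  define f where "f s = (u (- s) * v t + v (- s) * u t) * h s" for s
  define g where "g s = (u (- s) * v t - v (- s) * u t) * h s" for s
  have f: "f absolutely_integrable_on {p..q}" and g: "g absolutely_integrable_on {p..q}" for p q
    unfolding f_def g_def
    by (intro continuous_mult_integrable_absolutely_integrable_on h continuous_intros ur vr)+
  have gr: "(\<lambda>s. g (- s)) absolutely_integrable_on {p..q}" for p q
    unfolding g_def minus_minus
    by (intro continuous_mult_integrable_absolutely_integrable_on hr continuous_intros u v)+
  have A: "(\<lambda>s. v (- s) * h s - v s * h (- s)) absolutely_integrable_on {p..q}"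
    and B: "(\<lambda>s. u (- s) * h s + u s * h (- s)) absolutely_integrable_on {p..q}" for p q
    by (intro set_integral_add(1) set_integral_diff(1)
        continuous_mult_integrable_absolutely_integrable_on h hr ur vr u v)+
  note ai = absolutely_integrable_imp_interval_lebesgue_integrable
  have G: "G u v t s * h s = (oriented_char 0 t s * f s + oriented_char (- t) 0 s * g s) / 2" for s
    by (simp add: G_def f_def g_def algebra_simps)
  show "integrable lebesgue (\<lambda>s. G u v t s * h s)"
    unfolding G using oriented_char_integral(1)[OF f] oriented_char_integral(1)[OF g] by simp
  have "(LINT s|lebesgue. G u v t s * h s) = ((LINT s=ereal 0..t|lebesgue. f s) + (LINT s=ereal (- t)..ereal 0|lebesgue. g s)) / 2"
    unfolding G using oriented_char_integral[OF f] oriented_char_integral[OF g] by simp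
  \<comment> \<open>Reflection and reversal of orientation each contribute a sign, and the two
    cancel.\<close>
  also have "(LINT s=ereal (- t)..ereal 0|lebesgue. g s) = (LINT s=ereal 0..t|lebesgue. g (- s))"
    using interval_lebesgue_integral_reflect[OF g, of t] interval_lebesgue_integral_lebesgue_reverse[of "ereal (- t)" 0 g]
    by (simp add: zero_ereal_def[symmetric])
  also have "(LINT s=ereal 0..t|lebesgue. f s) + (LINT s=ereal 0..t|lebesgue. g (- s)) = (LINT s=ereal 0..t|lebesgue. (f s + g (- s)))"
    by (rule interval_lebesgue_integral_add(2)[symmetric]; intro ai f gr)
  \<comment> \<open>Regrouping by the factors \<open>u t\<close> and \<open>v t\<close> produces the
    integrands of \<open>u0_eq\<close>.\<close>
  also have "(\<lambda>s. f s + g (- s)) = (\<lambda>s. u t * (v (- s) * h s - v s * h (- s)) + v t * (u (- s) * h s + u s * h (- s)))"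
    by (auto simp: f_def g_def algebra_simps)
  also have "(LINT s=ereal 0..t|lebesgue. (u t * (v (- s) * h s - v s * h (- s)) + v t * (u (- s) * h s + u s * h (- s)))) =
    (LINT s=ereal 0..t|lebesgue. (u t * (v (- s) * h s - v s * h (- s)))) + (LINT s=ereal 0..t|lebesgue. (v t * (u (- s) * h s + u s * h (- s))))"
    by (intro interval_lebesgue_integral_add(2) interval_lebesgue_integrable_mult_right ai A B)
  finally show "(LINT s|lebesgue. G u v t s * h s) = u0 h u v t"
    unfolding u0_eq by (simp add: zero_ereal_def[symmetric])
qed

section \<open>Variation of constants\<close>

text \<open>Without a source the reflected Wronskian for \<open>\<sigma> = - 1\<close> keeps its
  value at \<open>0\<close>. Up to sign it is the determinant of the linear system for
  \<open>x t\<close> and \<open>x (- t)\<close>, which is thus always solvable.\<close>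

lemma homogeneous_wronskian_eq:
  assumes "is_solution a b (\<lambda>_. 0) 0 1 u" "is_solution (- a) b (\<lambda>_. 0) 0 1 v"
  shows "v (- t) * u t + v t * u (- t) = 2"
  using reflected_wronskian_eq[of a b "\<lambda>_. 0" 0 1 u "- 1" 0 1 v t] assms
  by (simp add: is_solution_def interval_lebesgue_integral_def)

text \<open>This is the uniqueness half: the equation alone determines \<open>x\<close> up to the
  number \<open>x 0\<close>. The two Wronskians \<open>P\<close> and \<open>Q\<close> are linear
  equations in \<open>x t\<close> and \<open>x (- t)\<close>; weighting them by \<open>u t\<close>
  and \<open>v t\<close> eliminates \<open>x (- t)\<close>.\<close>

lemma solution_eq_u0_add:
  assumes h: "integrable lebesgue h"
    and u: "is_solution a b (\<lambda>_. 0) 0 1 u" and v: "is_solution (- a) b (\<lambda>_. 0) 0 1 v"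
    and x: "is_solution a b h t0 c x"
  shows "x t = u0 h u v t + x 0 * u t"
proof -
  define A where "A = (LINT s=0..t|lebesgue. (v (- s) * h s - v s * h (- s)))"
  define B where "B = (LINT s=0..t|lebesgue. (u (- s) * h s + u s * h (- s)))"
  have 0: "u 0 = 1" "v 0 = 1" using u v by (auto simp: is_solution_def)
  have P: "v (- t) * x t + v t * x (- t) = 2 * x 0 + A"
    using reflected_wronskian_eq[OF x, of "- 1" 0 1 v t] v h 0 by (simp add: A_def)
  have Q: "u (- t) * x t - u t * x (- t) = B"
    using reflected_wronskian_eq[OF x, of 1 0 1 u t] u h 0 by (simp add: B_def)
  have "2 * x t = (v (- t) * u t + v t * u (- t)) * x t"
    by (simp add: homogeneous_wronskian_eq[OF u v])
  also have "\<dots> = u t * (v (- t) * x t + v t * x (- t)) + v t * (u (- t) * x t - u t * x (- t))"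
    by (simp add: algebra_simps)
  also have "\<dots> = 2 * (u0 h u v t + x 0 * u t)"
    unfolding P Q u0_eq A_def B_def by (simp add: algebra_simps)
  finally show ?thesis by simp
qed

text \<open>This is the existence half. The coefficient \<open>k\<close> stays free and the value at
  \<open>t0\<close> is whatever results, so that \<open>k\<close> can be fitted to the initial
  condition later.\<close>

lemma is_solution_u0_add:
  assumes h: "integrable lebesgue h"
    and u: "is_solution a b (\<lambda>_. 0) 0 1 u" and v: "is_solution (- a) b (\<lambda>_. 0) 0 1 v"
  shows "is_solution a b h t0 (u0 h u v t0 + k * u t0) (\<lambda>t. u0 h u v t + k * u t)"
proof -
  have lu: "locally_abs_continuous u" and lv: "locally_abs_continuous v"
    using u v by (auto simp: is_solution_def)
  note hr = integrable_lebesgue_reflect[OF h]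
  define gA where "gA s = v (- s) * h s - v s * h (- s)" for s
  define gB where "gB s = u (- s) * h s + u s * h (- s)" for s
  have gA: "gA absolutely_integrable_on {p..q}" and gB: "gB absolutely_integrable_on {p..q}" for p q
    unfolding gA_def gB_def
    by (intro set_integral_add(1) set_integral_diff(1) h hr lu lv
        continuous_mult_integrable_absolutely_integrable_on
        locally_abs_continuous_imp_continuous_on locally_abs_continuous_reflect)+
  define A where "A t = (LINT s=0..t|lebesgue. gA s)" for t :: real
  define B where "B t = (LINT s=0..t|lebesgue. gB s)" for t :: real
  \<comment> \<open>The equation involves \<open>x (- t)\<close>; these parities, due to
    \<open>gA\<close> being odd and \<open>gB\<close> even, express it through \<open>A t\<close>
    and \<open>B t\<close>.\<close>
  have A_even: "A (- t) = A t" and B_odd: "B (- t) = - B t" for t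
  proof -
    have "(\<lambda>s. gA (- s)) = (\<lambda>s. - gA s)" "(\<lambda>s. gB (- s)) = gB"
      by (auto simp: gA_def gB_def)
    then show "A (- t) = A t" "B (- t) = - B t"
      using interval_lebesgue_integral_reflect[OF gA, of t] interval_lebesgue_integral_reflect[OF gB, of t]
      by (simp_all add: A_def B_def interval_lebesgue_integral_uminus)
  qed
  have lA: "locally_abs_continuous A" and lB: "locally_abs_continuous B"
    unfolding A_def B_def by (intro locally_abs_continuous_interval_lebesgue_integral gA gB)+
  define x where "x t = 1 / 2 * (u t * A t + v t * B t) + k * u t" for t
  have x: "u0 h u v t + k * u t = x t" for t
    by (simp add: x_def u0_eq A_def B_def gA_def gB_def)
  have "AE t in lebesgue. x differentiable (at t) \<and> deriv x t + a * x (- t) + b * x t = h t"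
    using is_solution_AE_has_derivative[OF u] is_solution_AE_has_derivative[OF v]
      AE_interval_lebesgue_integral_has_derivative[OF gA]
      AE_interval_lebesgue_integral_has_derivative[OF gB]
  proof eventually_elim
    case (elim t)
    have x': "(x has_real_derivative
      1 / 2 * (((0 - a * u (- t) - b * u t) * A t + gA t * u t) +
        ((0 - - a * v (- t) - b * v t) * B t + gB t * v t)) +
      k * (0 - a * u (- t) - b * u t)) (at t)"
      unfolding x_def
      by (intro DERIV_add DERIV_cmult DERIV_mult elim(1,2) elim(3,4)[folded A_def B_def])
    then have d: "deriv x t = 1 / 2 * (((0 - a * u (- t) - b * u t) * A t + gA t * u t) +
        ((0 - - a * v (- t) - b * v t) * B t + gB t * v t)) +
      k * (0 - a * u (- t) - b * u t)"
      by (rule DERIV_imp_deriv)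
    have xm: "x (- t) = 1 / 2 * (u (- t) * A t - v (- t) * B t) + k * u (- t)"
      by (simp add: x_def A_even B_odd)
    \<comment> \<open>The terms with \<open>h (- t)\<close> cancel, and \<open>h t\<close> is
      multiplied by the constant Wronskian \<open>2\<close>, which the factor \<open>1 / 2\<close>
      in \<open>x\<close> offsets.\<close>
    have "gA t * u t + gB t * v t = (v (- t) * u t + v t * u (- t)) * h t"
      by (simp add: gA_def gB_def algebra_simps)
    then have w: "gA t * u t + gB t * v t = 2 * h t"
      by (simp add: homogeneous_wronskian_eq[OF u v])
    have "deriv x t + a * x (- t) + b * x t = h t"
      using w unfolding d xm x_def[of t] by (simp add: algebra_simps)
    then show ?case
      using x' real_differentiable_def by blast
  qed
  moreover have "locally_abs_continuous x"
    unfolding x_def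
    by (intro locally_abs_continuous_add locally_abs_continuous_mult locally_abs_continuous_const lu lv lA lB)
  ultimately show ?thesis
    unfolding x is_solution_def by simp
qed

text \<open>The equivalence combines existence and uniqueness. The integrability clause guarantees
  that the integral against \<open>G\<close> is not the default value \<open>0\<close> of a
  non-integrable function.\<close>

theorem mainTheorem2:
  fixes h u v :: "real \<Rightarrow> real" and a b c t0 :: real
  assumes h: "integrable lebesgue h"
    and u: "is_solution a b (\<lambda>_. 0) 0 1 u"
    and v: "is_solution (- a) b (\<lambda>_. 0) 0 1 v"
    and u_t0: "u t0 \<noteq> 0"
  shows "(\<forall>t. integrable lebesgue (\<lambda>s. G u v t s * h s)) \<and>
    (\<forall>x. is_solution a b h t0 c x \<longleftrightarrow>
      x = (\<lambda>t. (LINT s|lebesgue. (G u v t s * h s)) + (c - u0 h u v t0) / u t0 * u t))"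
proof -
  have cont: "continuous_on UNIV u" "continuous_on UNIV v"
    using u v by (auto simp: is_solution_def intro: locally_abs_continuous_imp_continuous_on)
  \<comment> \<open>The only coefficient of \<open>u\<close> that gives the value \<open>c\<close>
    at \<open>t0\<close>.\<close>
  define k where "k = (c - u0 h u v t0) / u t0"
  have k: "u0 h u v t0 + k * u t0 = c"
    using u_t0 by (simp add: k_def)
  have "is_solution a b h t0 c x \<longleftrightarrow> x = (\<lambda>t. u0 h u v t + k * u t)" for x
  proof
    assume x: "is_solution a b h t0 c x"
    have eq: "x t = u0 h u v t + x 0 * u t" for t
      by (rule solution_eq_u0_add[OF h u v x])
    have "x t0 = c"
      using x by (simp add: is_solution_def)
    then have x0: "x 0 = k"
      using eq[of t0] u_t0 by (simp add: k_def eq_divide_eq)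
    show "x = (\<lambda>t. u0 h u v t + k * u t)"
      using eq unfolding x0 by (rule ext)
  next
    assume "x = (\<lambda>t. u0 h u v t + k * u t)"
    then show "is_solution a b h t0 c x"
      using is_solution_u0_add[OF h u v, of t0 k] unfolding k by simp
  qed
  then show ?thesis
    using G_integral[OF h cont] by (simp add: k_def)
qed

end
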